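(* Let $f_0,f_1$ be probability densities and $\varphi=(\varphi_1,\dots,\varphi_s)^{\top}$ a dictionary satisfying the moment assumption of the context, and suppose $Y\neq 0$. (i) For every statistic $\psi=k_0+\mathbf k^{\top}\varphi$ with $k_0\in\mathbb R$, $\mathbf k\in\mathbb R^s$ and $\mathbf k^{\top}Y\neq0$ (the domain on which $\mathcal R$ is defined), $$\mathcal R[\psi]=\frac{\mathrm{Var}_0\psi+\mathrm{Var}_1\psi}{(\mathbb E_1\psi-\mathbb E_0\psi)^2}=\frac{\mathbf k^{\top}(C_0+C_1)\mathbf k}{(\mathbf k^{\top}Y)^2}\ \ge\ \frac{2}{J(s)},$$ with equality if and only if $\mathbf k=cK$ for a scalar $c\neq0$, where $K=F^{-1}Y$. The stationarity condition of $\mathcal R$ is $$\nabla_{\mathbf k}\mathcal R[\psi]=0\iff (C_0+C_1)\,\mathbf k\propto Y,$$ and the normal system $FK=Y$ is this condition with the scale fixed by $FK=Y$. (ii) The function $\Lambda^{(s)}$ is a rescaled projection of the bounded score $h^*$: $$\Lambda^{(s)}=\Bigl(1+\frac{J(s)}{2}\Bigr)\Pi_s h^{*},\qquad \|\Pi_s h^{*}\|_m^2=\frac{J(s)}{2+J(s)}.$$ For a dictionary that is orthonormal and centred in $L^2(m)$ (i.e. $\int\varphi_i\varphi_j\,m\,dx=\delta_{ij}$ and $\int\varphi_i\,m\,dx=0$), the entries of $Y$ are twice the Fourier coefficients of $h^*$, that is, $Y_i=2\langle\varphi_i,h^*\rangle_{L^2(m)}$; and as the dictionary is completed (i.e. along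 a sequence of such features $\varphi_1,\varphi_2,\dots$ for which $\{1,\varphi_1,\varphi_2,\dots\}$ is complete in $L^2(m)$) the partial sums $\Pi_s h^*$ converge to $h^*$ in $L^2(m)$ as $s\to\infty$, by the Riesz–Fischer theorem.
   Context: $f_0$ and $f_1$ are probability densities on $\mathbb R$. $\mathbb E_j,\mathrm{Var}_j,\mathrm{Cov}_j$ ($j=0,1$) refer to one observation $x$ with density $f_j$. A dictionary of order $s$ is a vector $\varphi=(\varphi_1,\dots,\varphi_s)^{\top}$ of real functions of $x$. Notation: $u_j=\mathbb E_j\varphi$, $C_j=\mathrm{Cov}_j\varphi$, $F=C_0+C_1$, $Y=u_1-u_0$, $K=F^{-1}Y$, $J(s)=Y^{\top}F^{-1}Y$, and $$\Lambda^{(s)}(x)=K^{\top}\bigl(\varphi(x)-\tfrac12(u_0+u_1)\bigr).$$ Moment assumption: every $\varphi_i$ has a finite second moment under $f_0$ and under $f_1$; $C_0$ is positive definite; $f_1$ vanishes wherever $f_0$ does. (Hence $F$ is positive definite and $K$ is well defined.) $m=\tfrac12(f_0+f_1)$ is the average law, $L^2(m)$ the space of functions with finite second moment under $m$, with norm $\|\cdot\|_m$. The bounded score is $h^*=(f_1-f_0)/(f_1+f_0)$, defined $m$-almost everywhere, with $|h^*|\le1$; $h^*=\tanh(\ell/2)$ wherever $\ell=\ln(f_1/f_0)$ is finite. $\Pi_s$ is the orthogonal projection in $L^2(m)$ onto $\mathrm{span}\{1,\varphi_1,\dots,\varphi_s\}$.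
   Formalization: The lower bound in (i), and the value at which equality holds, is 1/J(s) instead of 2/J(s): with F = C_0 + C_1 the choice k = K gives R = J/J^2 = 1/J < 2/J, so the printed bound always fails. *)

theory Defs
  imports "HOL-Probability.Probability"
begin

definition prob_density :: "(real \<Rightarrow> real) \<Rightarrow> bool" where
  "prob_density f \<longleftrightarrow>
     f \<in> borel_measurable borel \<and> (\<forall>x. 0 \<le> f x) \<and> has_bochner_integral lborel f 1"

definition law :: "(real \<Rightarrow> real) \<Rightarrow> real measure" where
  "law f = density lborel (\<lambda>x. ennreal (f x))"

definition avg_law :: "(real \<Rightarrow> real) \<Rightarrow> (real \<Rightarrow> real) \<Rightarrow> real measure" where
  "avg_law f0 f1 = law (\<lambda>x. (f0 x + f1 x) / 2)"

text \<open>Elements of \<open>L\<^sup>2\<close> are represented by functions; equality in \<open>L\<^sup>2\<close> is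
  equality almost everywhere.\<close>

definition L2 :: "real measure \<Rightarrow> (real \<Rightarrow> real) set" where
  "L2 M = {g. g \<in> borel_measurable M \<and> integrable M (\<lambda>x. (g x)\<^sup>2)}"

definition L2_inner :: "real measure \<Rightarrow> (real \<Rightarrow> real) \<Rightarrow> (real \<Rightarrow> real) \<Rightarrow> real" where
  "L2_inner M g h = (\<integral>x. g x * h x \<partial>M)"

definition L2_norm :: "real measure \<Rightarrow> (real \<Rightarrow> real) \<Rightarrow> real" where
  "L2_norm M g = sqrt (L2_inner M g g)"

text \<open>A representative of the orthogonal projection of \<open>h\<close> onto the linear space \<open>V\<close>; where
  a projection exists, it is unique up to equality almost everywhere.\<close>

definition L2_proj :: "real measure \<Rightarrow> (real \<Rightarrow> real) set \<Rightarrow> (real \<Rightarrow> real) \<Rightarrow> real \<Rightarrow> real" where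
  "L2_proj M V h = (SOME p. p \<in> V \<and> (\<forall>v\<in>V. L2_inner M (\<lambda>x. h x - p x) v = 0))"

text \<open>The linear span of the constant function \<open>1\<close> and the \<open>\<phi> i\<close> with \<open>i \<in> I\<close>, for finite \<open>I\<close>.\<close>

definition span1 :: "'i set \<Rightarrow> ('i \<Rightarrow> real \<Rightarrow> real) \<Rightarrow> (real \<Rightarrow> real) set" where
  "span1 I \<phi> = {(\<lambda>x. k0 + (\<Sum>i\<in>I. k i * \<phi> i x)) | k0 k. True}"

definition orthonormal_centred :: "real measure \<Rightarrow> ('i \<Rightarrow> real \<Rightarrow> real) \<Rightarrow> bool" where
  "orthonormal_centred M \<phi> \<longleftrightarrow>
     (\<forall>i j. L2_inner M (\<phi> i) (\<phi> j) = (if i = j then 1 else 0)) \<and>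
     (\<forall>i. (\<integral>x. \<phi> i x \<partial>M) = 0)"

text \<open>Completeness of \<open>{1, \<phi> 0, \<phi> 1, \<dots>}\<close>: its linear span is dense in \<open>L\<^sup>2\<close>.\<close>

definition complete_with_one :: "real measure \<Rightarrow> (nat \<Rightarrow> real \<Rightarrow> real) \<Rightarrow> bool" where
  "complete_with_one M \<phi> \<longleftrightarrow>
     (\<forall>g\<in>L2 M. \<forall>\<epsilon>>0. \<exists>s. \<exists>p\<in>span1 {..<s} \<phi>. L2_norm M (\<lambda>x. g x - p x) < \<epsilon>)"

definition bounded_score :: "(real \<Rightarrow> real) \<Rightarrow> (real \<Rightarrow> real) \<Rightarrow> real \<Rightarrow> real" where
  "bounded_score f0 f1 x = (f1 x - f0 x) / (f1 x + f0 x)"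

definition dict_vec :: "('n::finite \<Rightarrow> real \<Rightarrow> real) \<Rightarrow> real \<Rightarrow> real ^ 'n" where
  "dict_vec \<phi> x = (\<chi> i. \<phi> i x)"

definition mean_vec :: "(real \<Rightarrow> real) \<Rightarrow> ('n::finite \<Rightarrow> real \<Rightarrow> real) \<Rightarrow> real ^ 'n" where
  "mean_vec f \<phi> = (\<chi> i. \<integral>x. \<phi> i x \<partial>law f)"

definition cov_mat :: "(real \<Rightarrow> real) \<Rightarrow> ('n::finite \<Rightarrow> real \<Rightarrow> real) \<Rightarrow> real ^ 'n ^ 'n" where
  "cov_mat f \<phi> = (\<chi> i j. \<integral>x. (\<phi> i x - mean_vec f \<phi> $ i) * (\<phi> j x - mean_vec f \<phi> $ j) \<partial>law f)"

definition pos_def :: "real ^ 'n ^ 'n \<Rightarrow> bool" where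
  "pos_def A \<longleftrightarrow> transpose A = A \<and> (\<forall>v. v \<noteq> 0 \<longrightarrow> 0 < v \<bullet> (A *v v))"

definition moment_assumption ::
  "(real \<Rightarrow> real) \<Rightarrow> (real \<Rightarrow> real) \<Rightarrow> ('n::finite \<Rightarrow> real \<Rightarrow> real) \<Rightarrow> bool" where
  "moment_assumption f0 f1 \<phi> \<longleftrightarrow>
     (\<forall>i. \<phi> i \<in> L2 (law f0) \<and> \<phi> i \<in> L2 (law f1)) \<and>
     pos_def (cov_mat f0 \<phi>) \<and>
     (\<forall>x. f0 x = 0 \<longrightarrow> f1 x = 0)"

definition F_mat ::
  "(real \<Rightarrow> real) \<Rightarrow> (real \<Rightarrow> real) \<Rightarrow> ('n::finite \<Rightarrow> real \<Rightarrow> real) \<Rightarrow> real ^ 'n ^ 'n" where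
  "F_mat f0 f1 \<phi> = cov_mat f0 \<phi> + cov_mat f1 \<phi>"

definition Y_vec ::
  "(real \<Rightarrow> real) \<Rightarrow> (real \<Rightarrow> real) \<Rightarrow> ('n::finite \<Rightarrow> real \<Rightarrow> real) \<Rightarrow> real ^ 'n" where
  "Y_vec f0 f1 \<phi> = mean_vec f1 \<phi> - mean_vec f0 \<phi>"

definition K_vec ::
  "(real \<Rightarrow> real) \<Rightarrow> (real \<Rightarrow> real) \<Rightarrow> ('n::finite \<Rightarrow> real \<Rightarrow> real) \<Rightarrow> real ^ 'n" where
  "K_vec f0 f1 \<phi> = matrix_inv (F_mat f0 f1 \<phi>) *v Y_vec f0 f1 \<phi>"

definition J_val ::
  "(real \<Rightarrow> real) \<Rightarrow> (real \<Rightarrow> real) \<Rightarrow> ('n::finite \<Rightarrow> real \<Rightarrow> real) \<Rightarrow> real" where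
  "J_val f0 f1 \<phi> = Y_vec f0 f1 \<phi> \<bullet> (matrix_inv (F_mat f0 f1 \<phi>) *v Y_vec f0 f1 \<phi>)"

definition Lam ::
  "(real \<Rightarrow> real) \<Rightarrow> (real \<Rightarrow> real) \<Rightarrow> ('n::finite \<Rightarrow> real \<Rightarrow> real) \<Rightarrow> real \<Rightarrow> real" where
  "Lam f0 f1 \<phi> x =
     K_vec f0 f1 \<phi> \<bullet> (dict_vec \<phi> x - (1/2) *\<^sub>R (mean_vec f0 \<phi> + mean_vec f1 \<phi>))"

definition stat :: "('n::finite \<Rightarrow> real \<Rightarrow> real) \<Rightarrow> real \<Rightarrow> real ^ 'n \<Rightarrow> real \<Rightarrow> real" where
  "stat \<phi> k0 k x = k0 + k \<bullet> dict_vec \<phi> x"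

text \<open>The criterion \<open>\<R>[\<psi>]\<close>, meaningful when the two means of \<open>\<psi>\<close> differ. For an affine statistic
  with coefficient vector \<open>K\<close> its value is \<open>J / J\<^sup>2 = 1 / J\<close>; with \<open>F = C\<^sub>0 + C\<^sub>1\<close> this,
  and not \<open>2 / J\<close>, is the minimum over affine statistics.\<close>

definition crit :: "(real \<Rightarrow> real) \<Rightarrow> (real \<Rightarrow> real) \<Rightarrow> (real \<Rightarrow> real) \<Rightarrow> real" where
  "crit f0 f1 \<psi> =
     (prob_space.variance (law f0) \<psi> + prob_space.variance (law f1) \<psi>) /
     (prob_space.expectation (law f1) \<psi> - prob_space.expectation (law f0) \<psi>)\<^sup>2"

end

theory Submission
  imports Defs
begin

text \<open>The ratio in (i) is \<open>k \<bullet> F k / (k \<bullet> F K)\<^sup>2\<close> with \<open>F\<close> positive definite, so the bound and its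
  equality case are Cauchy-Schwarz for the inner product of \<open>F\<close>. For (ii), weighting the average law by
  \<open>h\<^sup>*\<close> gives \<open>\<integral> h\<^sup>* g dm = (E\<^sub>1 g - E\<^sub>0 g) / 2\<close>, while the covariance of \<open>\<phi>\<close> under \<open>m\<close> is
  \<open>F / 2 + Y Y\<^sup>T / 4\<close> and maps \<open>K\<close> to \<open>(1 + J / 2) Y / 2\<close>; hence \<open>h\<^sup>* - \<Lambda> / (1 + J / 2)\<close> is
  orthogonal to \<open>1\<close> and all \<open>\<phi>\<^sub>i\<close>. Convergence for complete dictionaries is the best
  approximation property of projections.\<close>

section \<open>Square-integrable functions and projections\<close>

lemma L2_measurable: "g \<in> L2 M \<Longrightarrow> g \<in> borel_measurable M"
  by (simp add: L2_def)

text \<open>The square sum dominates the product, by the inequality of arithmetic and geometric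
  means. This makes the inner product bilinear on \<open>L2 M\<close>, Bochner integrals being
  additive only on integrable functions.\<close>

lemma L2_mult_integrable:
  assumes "g \<in> L2 M" "h \<in> L2 M"
  shows "integrable M (\<lambda>x. g x * h x)"
proof (rule Bochner_Integration.integrable_bound)
  show "integrable M (\<lambda>x. (g x)\<^sup>2 + (h x)\<^sup>2)"
    using assms by (simp add: L2_def)
  show "(\<lambda>x. g x * h x) \<in> borel_measurable M"
    by (intro borel_measurable_times L2_measurable assms)
  have "\<bar>a * b\<bar> \<le> a\<^sup>2 + b\<^sup>2" for a b :: real
  proof -
    have "2 * \<bar>a * b\<bar> \<le> a\<^sup>2 + b\<^sup>2"
      using sum_squares_bound[of "\<bar>a\<bar>" "\<bar>b\<bar>"] by (simp add: abs_mult)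
    then show ?thesis using abs_ge_zero[of "a * b"] by linarith
  qed
  then show "AE x in M. norm (g x * h x) \<le> norm ((g x)\<^sup>2 + (h x)\<^sup>2)"
    by (intro AE_I2) simp
qed

lemma L2_add:
  assumes "g \<in> L2 M" "h \<in> L2 M"
  shows "(\<lambda>x. g x + h x) \<in> L2 M"
proof -
  have "integrable M (\<lambda>x. (g x)\<^sup>2 + (h x)\<^sup>2 + 2 * (g x * h x))"
    using assms L2_mult_integrable[OF assms] by (simp add: L2_def)
  then have "integrable M (\<lambda>x. (g x + h x)\<^sup>2)"
    by (simp add: power2_sum mult.assoc)
  moreover have "(\<lambda>x. g x + h x) \<in> borel_measurable M"
    by (intro borel_measurable_add L2_measurable assms)
  ultimately show ?thesis by (simp add: L2_def)
qed

lemma L2_cmult: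
  assumes "g \<in> L2 M"
  shows "(\<lambda>x. c * g x) \<in> L2 M"
  using assms by (auto simp: L2_def power_mult_distrib)

lemma L2_diff:
  assumes "g \<in> L2 M" "h \<in> L2 M"
  shows "(\<lambda>x. g x - h x) \<in> L2 M"
  using L2_add[OF assms(1) L2_cmult[OF assms(2), of "-1"]] by simp

lemma L2_const:
  assumes "finite_measure M"
  shows "(\<lambda>x. c) \<in> L2 M"
  using assms by (simp add: L2_def finite_measure.integrable_const)

lemma L2_sum:
  assumes "finite_measure M" "\<And>i. i \<in> I \<Longrightarrow> g i \<in> L2 M"
  shows "(\<lambda>x. \<Sum>i\<in>I. g i x) \<in> L2 M"
  using assms(2)
proof (induction I rule: infinite_finite_induct)
  case (insert i I)
  then show ?case using L2_add[of "g i" M "\<lambda>x. \<Sum>i\<in>I. g i x"] by simp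
qed (simp_all add: L2_const[OF assms(1)])

text \<open>Pair \<open>g\<close> with the constant 1, which is square-integrable because the
  measure is finite.\<close>

lemma L2_integrable:
  assumes "finite_measure M" "g \<in> L2 M"
  shows "integrable M g"
  using L2_mult_integrable[OF assms(2) L2_const[OF assms(1), of 1]] by simp

lemma L2_inner_commute: "L2_inner M g h = L2_inner M h g"
  by (simp add: L2_inner_def mult.commute)

lemma L2_inner_diff_left:
  assumes "g \<in> L2 M" "h \<in> L2 M" "v \<in> L2 M"
  shows "L2_inner M (\<lambda>x. g x - h x) v = L2_inner M g v - L2_inner M h v"
  using assms by (simp add: L2_inner_def left_diff_distrib L2_mult_integrable)

lemma L2_inner_diff_right:
  assumes "g \<in> L2 M" "h \<in> L2 M" "v \<in> L2 M"
  shows "L2_inner M v (\<lambda>x. g x - h x) = L2_inner M v g - L2_inner M v h"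
  using L2_inner_diff_left[OF assms] by (simp add: L2_inner_commute)

lemma L2_inner_self_nonneg: "0 \<le> L2_inner M g g"
  by (simp add: L2_inner_def)

lemma L2_norm_nonneg: "0 \<le> L2_norm M g"
  by (simp add: L2_norm_def L2_inner_self_nonneg)

lemma L2_inner_self_eq_0:
  assumes "g \<in> L2 M" "L2_inner M g g = 0"
  shows "AE x in M. g x = 0"
proof -
  have "AE x in M. g x * g x = 0"
    using assms integral_nonneg_eq_0_iff_AE[of M "\<lambda>x. g x * g x"]
    by (simp add: L2_inner_def L2_mult_integrable)
  then show ?thesis by simp
qed

section \<open>Orthogonal projections\<close>

text \<open>\<open>L2_proj\<close> is a choice, so its characteristic properties become available
  once some candidate \<open>p\<close> is exhibited. The candidates supplied later are explicit:
  Fourier sums, and the rescaled \<Lambda>.\<close>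

lemma L2_proj_orthogonal:
  assumes "p \<in> V" "\<And>v. v \<in> V \<Longrightarrow> L2_inner M (\<lambda>x. h x - p x) v = 0"
  shows L2_proj_in: "L2_proj M V h \<in> V"
    and L2_inner_residual: "\<And>v. v \<in> V \<Longrightarrow> L2_inner M (\<lambda>x. h x - L2_proj M V h x) v = 0"
proof -
  have "\<exists>p. p \<in> V \<and> (\<forall>v\<in>V. L2_inner M (\<lambda>x. h x - p x) v = 0)"
    using assms by blast
  from someI_ex[OF this]
  show "L2_proj M V h \<in> V" "\<And>v. v \<in> V \<Longrightarrow> L2_inner M (\<lambda>x. h x - L2_proj M V h x) v = 0"
    unfolding L2_proj_def by blast+
qed

text \<open>The difference of the two projections lies in \<open>V\<close> and is also a difference
  of two residuals, each orthogonal to \<open>V\<close>. It is therefore orthogonal to itself and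
  vanishes almost everywhere.\<close>

lemma L2_proj_unique:
  assumes V: "V \<subseteq> L2 M" "\<And>u v. u \<in> V \<Longrightarrow> v \<in> V \<Longrightarrow> (\<lambda>x. u x - v x) \<in> V"
    and h: "h \<in> L2 M" and p: "p \<in> V"
    and orth: "\<And>v. v \<in> V \<Longrightarrow> L2_inner M (\<lambda>x. h x - p x) v = 0"
  shows "AE x in M. L2_proj M V h x = p x"
proof -
  let ?q = "L2_proj M V h" and ?d = "\<lambda>x. L2_proj M V h x - p x"
  note q = L2_proj_orthogonal[OF p orth]
  have d: "?d \<in> V" using V(2) q(1) p by blast
  have "L2_inner M ?d ?d = L2_inner M (\<lambda>x. (h x - p x) - (h x - ?q x)) ?d"
    by simp
  also have "\<dots> = 0"
    using L2_inner_diff_left[of "\<lambda>x. h x - p x" M "\<lambda>x. h x - ?q x" ?d] V(1) h p d q orth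
    by (simp add: L2_diff subset_iff)
  finally show ?thesis
    using L2_inner_self_eq_0[of ?d M] d V(1) by auto
qed

text \<open>Pythagoras: \<open>h - v\<close> splits into the residual \<open>h - p\<close> and the
  element \<open>v - p\<close> of \<open>V\<close>, which are orthogonal, so replacing
  \<open>p\<close> by \<open>v\<close> can only add a nonnegative term.\<close>

lemma L2_proj_best_approximation:
  assumes V: "V \<subseteq> L2 M" "\<And>u v. u \<in> V \<Longrightarrow> v \<in> V \<Longrightarrow> (\<lambda>x. u x - v x) \<in> V"
    and h: "h \<in> L2 M" and p: "p \<in> V" and v: "v \<in> V"
    and orth: "\<And>v. v \<in> V \<Longrightarrow> L2_inner M (\<lambda>x. h x - p x) v = 0"
  shows "L2_norm M (\<lambda>x. p x - h x) \<le> L2_norm M (\<lambda>x. h x - v x)"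
proof -
  let ?r = "\<lambda>x. h x - p x" and ?d = "\<lambda>x. v x - p x"
  have d: "?d \<in> V" using V(2) p v by blast
  have L2: "?r \<in> L2 M" "?d \<in> L2 M" using h p d V(1) by (auto intro: L2_diff)
  have "L2_inner M (\<lambda>x. h x - v x) (\<lambda>x. h x - v x)
      = L2_inner M (\<lambda>x. ?r x - ?d x) (\<lambda>x. ?r x - ?d x)"
    by simp
  also have "\<dots> = L2_inner M ?r ?r + L2_inner M ?d ?d - 2 * L2_inner M ?r ?d"
    unfolding L2_inner_diff_left[OF L2 L2_diff[OF L2]] L2_inner_diff_right[OF L2 L2(1)]
      L2_inner_diff_right[OF L2 L2(2)]
    using L2_inner_commute[of M ?d ?r] by linarith
  also have "L2_inner M ?r ?d = 0" by (rule orth[OF d])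
  finally have "L2_inner M ?r ?r \<le> L2_inner M (\<lambda>x. h x - v x) (\<lambda>x. h x - v x)"
    using L2_inner_self_nonneg[of M ?d] by simp
  moreover have "L2_inner M (\<lambda>x. p x - h x) (\<lambda>x. p x - h x) = L2_inner M ?r ?r"
    unfolding L2_inner_def by (rule Bochner_Integration.integral_cong) (auto simp: algebra_simps)
  ultimately show ?thesis
    unfolding L2_norm_def by simp
qed

section \<open>Spans of a dictionary together with the constants\<close>

lemma span1_subset_L2:
  assumes "finite_measure M" "\<And>i. i \<in> I \<Longrightarrow> \<phi> i \<in> L2 M"
  shows "span1 I \<phi> \<subseteq> L2 M"
  using assms by (auto simp: span1_def intro!: L2_add L2_const L2_sum L2_cmult)

lemma span1_diff:
  assumes "u \<in> span1 I \<phi>" "v \<in> span1 I \<phi>"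
  shows "(\<lambda>x. u x - v x) \<in> span1 I \<phi>"
proof -
  obtain a k where u: "u = (\<lambda>x. a + (\<Sum>i\<in>I. k i * \<phi> i x))"
    using assms(1) by (auto simp: span1_def)
  obtain b l where v: "v = (\<lambda>x. b + (\<Sum>i\<in>I. l i * \<phi> i x))"
    using assms(2) by (auto simp: span1_def)
  have "(\<lambda>x. u x - v x) = (\<lambda>x. (a - b) + (\<Sum>i\<in>I. (k i - l i) * \<phi> i x))"
    by (simp add: u v left_diff_distrib sum_subtractf algebra_simps)
  then show ?thesis by (auto simp: span1_def)
qed

text \<open>Pad the coefficients with zeros outside \<open>I\<close>. An approximant found at one
  stage of a growing dictionary thus stays available at all later stages.\<close>

lemma span1_mono:
  assumes "finite J" "I \<subseteq> J"
  shows "span1 I \<phi> \<subseteq> span1 J \<phi>"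
proof
  fix u assume "u \<in> span1 I \<phi>"
  then obtain a k where u: "u = (\<lambda>x. a + (\<Sum>i\<in>I. k i * \<phi> i x))"
    by (auto simp: span1_def)
  have "(\<Sum>i\<in>I. k i * \<phi> i x) = (\<Sum>i\<in>J. (if i \<in> I then k i else 0) * \<phi> i x)" for x
    using assms by (intro sum.mono_neutral_cong_left) auto
  then show "u \<in> span1 J \<phi>"
    unfolding u span1_def by (intro CollectI exI[of _ a] exI[of _ "\<lambda>i. if i \<in> I then k i else 0"]) simp
qed

text \<open>By linearity, orthogonality to the span needs testing only against 1 and the
  generators.\<close>

lemma orthogonal_span1:
  assumes M: "finite_measure M" and r: "r \<in> L2 M" and \<phi>: "\<And>i. i \<in> I \<Longrightarrow> \<phi> i \<in> L2 M"
    and one: "(\<integral>x. r x \<partial>M) = 0" and orth: "\<And>i. i \<in> I \<Longrightarrow> L2_inner M r (\<phi> i) = 0"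
    and v: "v \<in> span1 I \<phi>"
  shows "L2_inner M r v = 0"
proof -
  obtain a k where v: "v = (\<lambda>x. a + (\<Sum>i\<in>I. k i * \<phi> i x))"
    using v by (auto simp: span1_def)
  have "L2_inner M r v = (\<integral>x. a * r x + (\<Sum>i\<in>I. k i * (r x * \<phi> i x)) \<partial>M)"
    unfolding L2_inner_def v
    by (rule Bochner_Integration.integral_cong) (simp_all add: algebra_simps sum_distrib_left)
  also have "\<dots> = a * (\<integral>x. r x \<partial>M) + (\<Sum>i\<in>I. k i * L2_inner M r (\<phi> i))"
    using L2_integrable[OF M r] L2_mult_integrable[OF r \<phi>]
    by (simp add: L2_inner_def Bochner_Integration.integral_sum)
  finally show ?thesis using one orth by simp
qed

section \<open>Fourier sums of orthonormal centred families\<close>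

text \<open>Orthonormality cancels the residual against each \<open>\<psi> j\<close>. Since
  \<open>h\<close> has mean zero and the family is centred, the coefficient of the constant function
  is 0, so the Fourier sum carries no constant term.\<close>

lemma orthonormal_fourier_residual:
  assumes M: "finite_measure M" and h: "h \<in> L2 M" and \<psi>: "\<And>i. \<psi> i \<in> L2 M"
    and on: "orthonormal_centred M \<psi>" and h0: "(\<integral>x. h x \<partial>M) = 0" and I: "finite I"
    and v: "v \<in> span1 I \<psi>"
  shows "L2_inner M (\<lambda>x. h x - (\<Sum>i\<in>I. L2_inner M (\<psi> i) h * \<psi> i x)) v = 0"
proof -
  let ?p = "\<lambda>x. \<Sum>i\<in>I. L2_inner M (\<psi> i) h * \<psi> i x"
  have p: "?p \<in> L2 M" using \<psi> by (intro L2_sum M L2_cmult)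
  show ?thesis
  proof (rule orthogonal_span1[OF M L2_diff[OF h p] \<psi> _ _ v])
    have "(\<integral>x. ?p x \<partial>M) = (\<Sum>i\<in>I. L2_inner M (\<psi> i) h * (\<integral>x. \<psi> i x \<partial>M))"
      using L2_integrable[OF M \<psi>] by (simp add: Bochner_Integration.integral_sum)
    also have "\<dots> = 0" using on by (simp add: orthonormal_centred_def)
    finally show "(\<integral>x. h x - ?p x \<partial>M) = 0"
      using L2_integrable[OF M h] L2_integrable[OF M p] h0 by simp
  next
    fix j assume j: "j \<in> I"
    have "L2_inner M ?p (\<psi> j) = (\<integral>x. (\<Sum>i\<in>I. L2_inner M (\<psi> i) h * (\<psi> i x * \<psi> j x)) \<partial>M)"
      unfolding L2_inner_def[of M _ "\<psi> j"]
      by (rule Bochner_Integration.integral_cong) (simp_all add: sum_distrib_right mult.assoc)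
    also have "\<dots> = (\<Sum>i\<in>I. L2_inner M (\<psi> i) h * L2_inner M (\<psi> i) (\<psi> j))"
      using L2_mult_integrable[OF \<psi> \<psi>] unfolding L2_inner_def[of M _ "\<psi> j"]
      by (simp add: Bochner_Integration.integral_sum)
    also have "\<dots> = (\<Sum>i\<in>I. if i = j then L2_inner M (\<psi> i) h else 0)"
      using on by (intro sum.cong) (auto simp: orthonormal_centred_def)
    also have "\<dots> = L2_inner M (\<psi> j) h" using I j by simp
    finally show "L2_inner M (\<lambda>x. h x - ?p x) (\<psi> j) = 0"
      using L2_inner_diff_left[OF h p \<psi>] by (simp add: L2_inner_commute)
  qed
qed

lemma orthonormal_proj:
  assumes M: "finite_measure M" and h: "h \<in> L2 M" and \<psi>: "\<And>i. \<psi> i \<in> L2 M"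
    and on: "orthonormal_centred M \<psi>" and h0: "(\<integral>x. h x \<partial>M) = 0" and I: "finite I"
  shows "AE x in M. L2_proj M (span1 I \<psi>) h x = (\<Sum>i\<in>I. L2_inner M (\<psi> i) h * \<psi> i x)"
proof (rule L2_proj_unique[OF span1_subset_L2[of M I \<psi>, OF M \<psi>] span1_diff h])
  show "(\<lambda>x. \<Sum>i\<in>I. L2_inner M (\<psi> i) h * \<psi> i x) \<in> span1 I \<psi>"
    unfolding span1_def by (intro CollectI exI[of _ 0] exI[of _ "\<lambda>i. L2_inner M (\<psi> i) h"]) simp
qed (assumption | rule orthonormal_fourier_residual[OF assms])+

text \<open>Density yields some \<open>v\<close> in the span of the first \<open>s\<close> features
  within \<open>e\<close> of \<open>h\<close>. The spans increase, so for every \<open>n\<close>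
  beyond \<open>s\<close> this \<open>v\<close> competes with the projection, which is at least as
  close to \<open>h\<close>.\<close>

lemma complete_orthonormal_proj_tendsto:
  assumes M: "finite_measure M" and h: "h \<in> L2 M" and \<psi>: "\<And>i. \<psi> i \<in> L2 M"
    and on: "orthonormal_centred M \<psi>" and h0: "(\<integral>x. h x \<partial>M) = 0"
    and complete: "complete_with_one M \<psi>"
  shows "(\<lambda>s. L2_norm M (\<lambda>x. L2_proj M (span1 {..<s} \<psi>) h x - h x)) \<longlonglongrightarrow> 0"
proof (rule LIMSEQ_I)
  fix e :: real assume "0 < e"
  then obtain s v where v: "v \<in> span1 {..<s} \<psi>" "L2_norm M (\<lambda>x. h x - v x) < e"
    using complete h unfolding complete_with_one_def by blast
  have "L2_norm M (\<lambda>x. L2_proj M (span1 {..<n} \<psi>) h x - h x) < e" if "s \<le> n" for n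
  proof -
    let ?p = "\<lambda>x. \<Sum>i<n. L2_inner M (\<psi> i) h * \<psi> i x"
    have p: "?p \<in> span1 {..<n} \<psi>"
      unfolding span1_def by (intro CollectI exI[of _ 0] exI[of _ "\<lambda>i. L2_inner M (\<psi> i) h"]) simp
    note q = L2_proj_orthogonal[OF p orthonormal_fourier_residual[OF M h \<psi> on h0 finite_lessThan]]
    have "v \<in> span1 {..<n} \<psi>" using span1_mono[of "{..<n}" "{..<s}" \<psi>] v(1) that by auto
    from L2_proj_best_approximation[OF span1_subset_L2[of M "{..<n}" \<psi>, OF M \<psi>] span1_diff h
        q(1) this q(2)]
    show ?thesis using v(2) by (rule le_less_trans)
  qed
  then show "\<exists>no. \<forall>n\<ge>no. norm (L2_norm M (\<lambda>x. L2_proj M (span1 {..<n} \<psi>) h x - h x) - 0) < e"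
    by (auto simp: L2_norm_nonneg)
qed

section \<open>Laws with a density\<close>

lemma sets_law [measurable_cong, simp]: "sets (law f) = sets borel"
  by (simp add: law_def)

lemma space_law [simp]: "space (law f) = UNIV"
  by (simp add: law_def)

lemma borel_measurable_law [simp]: "borel_measurable (law f) = borel_measurable borel"
  by (rule measurable_cong_sets) simp_all

lemma prob_space_law:
  assumes "prob_density f"
  shows "prob_space (law f)"
proof
  have "emeasure (law f) (space (law f)) = (\<integral>\<^sup>+x. ennreal (f x) \<partial>lborel)"
    using assms by (simp add: law_def prob_density_def emeasure_density)
  also have "\<dots> = ennreal (\<integral>x. f x \<partial>lborel)"
    using assms by (intro nn_integral_eq_integral)
      (auto simp: prob_density_def has_bochner_integral_iff)
  finally show "emeasure (law f) (space (law f)) = 1"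
    using assms by (simp add: prob_density_def has_bochner_integral_iff)
qed

lemma finite_measure_law: "prob_density f \<Longrightarrow> finite_measure (law f)"
  by (simp add: prob_space_law prob_space.finite_measure)

lemma prob_density_avg:
  assumes "prob_density f0" "prob_density f1"
  shows "prob_density (\<lambda>x. (f0 x + f1 x) / 2)"
  using assms by (auto simp: prob_density_def has_bochner_integral_iff)

lemma finite_measure_avg_law:
  "prob_density f0 \<Longrightarrow> prob_density f1 \<Longrightarrow> finite_measure (avg_law f0 f1)"
  unfolding avg_law_def by (intro finite_measure_law prob_density_avg)

lemma borel_measurable_avg_law [simp]:
  "borel_measurable (avg_law f0 f1) = borel_measurable borel"
  by (simp add: avg_law_def)

lemma integrable_law:
  fixes g :: "real \<Rightarrow> real"
  assumes "prob_density f" "g \<in> borel_measurable borel"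
  shows "integrable (law f) g \<longleftrightarrow> integrable lborel (\<lambda>x. f x * g x)"
  using assms unfolding law_def prob_density_def by (subst integrable_density) auto

lemma integral_law:
  fixes g :: "real \<Rightarrow> real"
  assumes "prob_density f" "g \<in> borel_measurable borel"
  shows "(\<integral>x. g x \<partial>law f) = (\<integral>x. f x * g x \<partial>lborel)"
  using assms unfolding law_def prob_density_def by (subst integral_density) auto

text \<open>The density of the average law is the mean of the two densities, so both claims reduce
  to linearity of the Lebesgue integral.\<close>

lemma
  fixes g :: "real \<Rightarrow> real"
  assumes d: "prob_density f0" "prob_density f1"
    and g: "integrable (law f0) g" "integrable (law f1) g"
  shows integrable_avg_law: "integrable (avg_law f0 f1) g"
    and integral_avg_law: "(\<integral>x. g x \<partial>avg_law f0 f1) = ((\<integral>x. g x \<partial>law f0) + (\<integral>x. g x \<partial>law f1)) / 2"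
proof -
  have m: "g \<in> borel_measurable borel" using borel_measurable_integrable[OF g(1)] by simp
  note i = g[unfolded integrable_law[OF d(1) m] integrable_law[OF d(2) m]]
  have eq: "(f0 x + f1 x) / 2 * g x = (f0 x * g x + f1 x * g x) / 2" for x
    by (simp add: field_simps)
  show "integrable (avg_law f0 f1) g"
    unfolding avg_law_def integrable_law[OF prob_density_avg[OF d] m] eq using i by simp
  show "(\<integral>x. g x \<partial>avg_law f0 f1) = ((\<integral>x. g x \<partial>law f0) + (\<integral>x. g x \<partial>law f1)) / 2"
    unfolding avg_law_def integral_law[OF prob_density_avg[OF d] m]
      integral_law[OF d(1) m] integral_law[OF d(2) m] eq
    using i by simp
qed

lemma L2_avg_law:
  assumes "prob_density f0" "prob_density f1" "g \<in> L2 (law f0)" "g \<in> L2 (law f1)"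
  shows "g \<in> L2 (avg_law f0 f1)"
  using assms integrable_avg_law[of f0 f1 "\<lambda>x. (g x)\<^sup>2"] by (simp add: L2_def)

section \<open>The bounded score as an element of \<open>L2\<close> of the average law\<close>

lemma bounded_score_L2:
  assumes d: "prob_density f0" "prob_density f1"
  shows "bounded_score f0 f1 \<in> L2 (avg_law f0 f1)"
proof -
  interpret finite_measure "avg_law f0 f1" by (rule finite_measure_avg_law[OF d])
  have [measurable]: "f0 \<in> borel_measurable borel" "f1 \<in> borel_measurable borel"
    using d by (auto simp: prob_density_def)
  have m: "bounded_score f0 f1 \<in> borel_measurable borel"
    unfolding bounded_score_def by measurable
  have "\<bar>bounded_score f0 f1 x\<bar> \<le> 1" for x
  proof -
    have "0 \<le> f0 x" "0 \<le> f1 x" using d by (auto simp: prob_density_def)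
    then have "\<bar>f1 x - f0 x\<bar> \<le> f1 x + f0 x" by linarith
    \<comment> \<open>Where both densities vanish the quotient is 0 by the convention for division
      by zero, so the bound holds at every point and not only almost everywhere.\<close>
    then show ?thesis unfolding bounded_score_def abs_divide
      by (cases "f1 x + f0 x = 0") (auto simp: divide_le_eq_1)
  qed
  then have "(bounded_score f0 f1 x)\<^sup>2 \<le> 1" for x
    by (simp add: abs_square_le_1)
  then have "integrable (avg_law f0 f1) (\<lambda>x. (bounded_score f0 f1 x)\<^sup>2)"
    using m by (intro integrable_const_bound[of _ 1]) auto
  with m show ?thesis by (simp add: L2_def)
qed

text \<open>Multiplying the density of the average law by the score gives
  \<open>(f1 - f0) / 2\<close>. Pairing with the score thus measures how far the two means of
  \<open>g\<close> are apart, which links the projection problem to \<open>Y\<close> and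
  \<open>J\<close>.\<close>

lemma integral_bounded_score_mult:
  fixes g :: "real \<Rightarrow> real"
  assumes d: "prob_density f0" "prob_density f1"
    and g: "integrable (law f0) g" "integrable (law f1) g"
  shows "(\<integral>x. bounded_score f0 f1 x * g x \<partial>avg_law f0 f1)
    = ((\<integral>x. g x \<partial>law f1) - (\<integral>x. g x \<partial>law f0)) / 2"
proof -
  have m: "g \<in> borel_measurable borel" using borel_measurable_integrable[OF g(1)] by simp
  note i = g[unfolded integrable_law[OF d(1) m] integrable_law[OF d(2) m]]
  have mh: "bounded_score f0 f1 \<in> borel_measurable borel"
    using L2_measurable[OF bounded_score_L2[OF d]] by simp
  have eq: "(f0 x + f1 x) / 2 * (bounded_score f0 f1 x * g x) = (f1 x * g x - f0 x * g x) / 2" for x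
  proof -
    have "0 \<le> f0 x" "0 \<le> f1 x" using d by (auto simp: prob_density_def)
    \<comment> \<open>If the sum of the densities is 0, nonnegativity forces both to be 0, so both
      sides vanish.\<close>
    then have "(f0 x + f1 x) * bounded_score f0 f1 x = f1 x - f0 x"
      unfolding bounded_score_def by (cases "f1 x + f0 x = 0") (auto simp: add.commute)
    then show ?thesis by (metis (no_types, lifting) left_diff_distrib mult.assoc times_divide_eq_left)
  qed
  have "(\<lambda>x. bounded_score f0 f1 x * g x) \<in> borel_measurable borel"
    using m mh by simp
  then show ?thesis
    unfolding avg_law_def
    by (simp only: integral_law[OF prob_density_avg[OF d]] eq
        integral_law[OF d(1) m] integral_law[OF d(2) m]) (use i in simp)
qed

lemma integral_bounded_score:
  assumes d: "prob_density f0" "prob_density f1"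
  shows "(\<integral>x. bounded_score f0 f1 x \<partial>avg_law f0 f1) = 0"
proof -
  interpret p0: prob_space "law f0" by (rule prob_space_law[OF d(1)])
  interpret p1: prob_space "law f1" by (rule prob_space_law[OF d(2)])
  show ?thesis
    using integral_bounded_score_mult[OF d, of "\<lambda>x. 1"] p0.prob_space p1.prob_space by simp
qed

section \<open>Affine statistics\<close>

lemma stat_eq_sum: "stat \<phi> k0 k = (\<lambda>x. k0 + (\<Sum>i\<in>UNIV. k $ i * \<phi> i x))"
  by (auto simp: stat_def dict_vec_def inner_vec_def)

lemma stat_in_span1: "stat \<phi> k0 k \<in> span1 UNIV \<phi>"
  unfolding stat_eq_sum span1_def by blast

lemma stat_L2:
  assumes "finite_measure M" "\<And>i. \<phi> i \<in> L2 M"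
  shows "stat \<phi> k0 k \<in> L2 M"
  using stat_in_span1 span1_subset_L2[of M UNIV \<phi>] assms by blast

lemma expectation_stat:
  assumes f: "prob_density f" and \<phi>: "\<And>i. \<phi> i \<in> L2 (law f)"
  shows "(\<integral>x. stat \<phi> k0 k x \<partial>law f) = k0 + k \<bullet> mean_vec f \<phi>"
proof -
  interpret prob_space "law f" by (rule prob_space_law[OF f])
  show ?thesis
    using L2_integrable[OF finite_measure_axioms \<phi>] prob_space
    by (simp add: stat_eq_sum mean_vec_def inner_vec_def Bochner_Integration.integral_sum)
qed

lemma cov_mat_entry:
  assumes f: "prob_density f" and \<phi>: "\<And>i. \<phi> i \<in> L2 (law f)"
  shows "cov_mat f \<phi> $ i $ j
    = (\<integral>x. \<phi> i x * \<phi> j x \<partial>law f) - mean_vec f \<phi> $ i * mean_vec f \<phi> $ j"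
proof -
  interpret prob_space "law f" by (rule prob_space_law[OF f])
  let ?u = "mean_vec f \<phi>"
  have u: "(\<integral>x. \<phi> i x \<partial>law f) = ?u $ i" for i by (simp add: mean_vec_def)
  have "cov_mat f \<phi> $ i $ j
      = (\<integral>x. \<phi> i x * \<phi> j x - ?u $ i * \<phi> j x - ?u $ j * \<phi> i x + ?u $ i * ?u $ j \<partial>law f)"
    unfolding cov_mat_def by (simp add: algebra_simps)
  also have "\<dots> = (\<integral>x. \<phi> i x * \<phi> j x \<partial>law f) - ?u $ i * ?u $ j"
    using L2_integrable[OF finite_measure_axioms \<phi>] L2_mult_integrable[OF \<phi> \<phi>] prob_space
    by (simp add: u)
  finally show ?thesis .
qed

text \<open>This cross moment serves twice: it gives the variance of an affine statistic, and with
  \<open>k = K\<close> the inner products of \<Lambda> with the dictionary.\<close>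

lemma expectation_mult_stat:
  assumes f: "prob_density f" and \<phi>: "\<And>i. \<phi> i \<in> L2 (law f)"
  shows "(\<integral>x. \<phi> i x * stat \<phi> k0 k x \<partial>law f)
    = (cov_mat f \<phi> *v k) $ i + mean_vec f \<phi> $ i * (k0 + k \<bullet> mean_vec f \<phi>)"
proof -
  interpret prob_space "law f" by (rule prob_space_law[OF f])
  let ?u = "mean_vec f \<phi>"
  have "(\<integral>x. \<phi> i x * stat \<phi> k0 k x \<partial>law f)
      = (\<integral>x. k0 * \<phi> i x + (\<Sum>j\<in>UNIV. k $ j * (\<phi> i x * \<phi> j x)) \<partial>law f)"
    by (rule Bochner_Integration.integral_cong)
      (simp_all add: stat_eq_sum algebra_simps sum_distrib_left)
  also have "\<dots> = k0 * ?u $ i + (\<Sum>j\<in>UNIV. k $ j * (cov_mat f \<phi> $ i $ j + ?u $ i * ?u $ j))"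
    using L2_integrable[OF finite_measure_axioms \<phi>] L2_mult_integrable[OF \<phi> \<phi>]
    by (simp add: Bochner_Integration.integral_sum cov_mat_entry[of f \<phi>, OF f \<phi>] mean_vec_def)
  also have "\<dots> = (cov_mat f \<phi> *v k) $ i + ?u $ i * (k0 + k \<bullet> ?u)"
    by (simp add: matrix_vector_mult_def inner_vec_def algebra_simps sum.distrib sum_distrib_left)
  finally show ?thesis .
qed

lemma variance_stat:
  assumes f: "prob_density f" and \<phi>: "\<And>i. \<phi> i \<in> L2 (law f)"
  shows "prob_space.variance (law f) (stat \<phi> k0 k) = k \<bullet> (cov_mat f \<phi> *v k)"
proof -
  interpret prob_space "law f" by (rule prob_space_law[OF f])
  \<comment> \<open>This constant centres the statistic under \<open>f\<close>. The shift leaves the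
    variance unchanged, and after one of the two factors is expanded every term containing a mean
    drops out.\<close>
  define c where "c = - (k \<bullet> mean_vec f \<phi>)"
  have st: "stat \<phi> c k \<in> L2 (law f)" by (rule stat_L2[OF finite_measure_axioms \<phi>])
  have "variance (stat \<phi> k0 k) = (\<integral>x. stat \<phi> c k x * stat \<phi> c k x \<partial>law f)"
    by (simp add: expectation_stat[of f \<phi>, OF f \<phi>]) (simp add: stat_def c_def power2_eq_square)
  also have "\<dots> = (\<integral>x. c * stat \<phi> c k x + (\<Sum>i\<in>UNIV. k $ i * (\<phi> i x * stat \<phi> c k x)) \<partial>law f)"
    by (rule Bochner_Integration.integral_cong)
      (simp_all add: stat_eq_sum[of \<phi> c k] distrib_right sum_distrib_right mult.assoc)
  also have "\<dots> = (\<Sum>i\<in>UNIV. k $ i * (cov_mat f \<phi> *v k) $ i)"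
    using L2_integrable[OF finite_measure_axioms st] L2_mult_integrable[OF \<phi> st]
    by (simp add: Bochner_Integration.integral_sum expectation_mult_stat[of f \<phi>, OF f \<phi>]
        expectation_stat[of f \<phi>, OF f \<phi>]) (simp add: c_def)
  finally show ?thesis by (simp add: inner_vec_def)
qed

lemma crit_stat:
  assumes d: "prob_density f0" "prob_density f1"
    and \<phi>: "\<And>i. \<phi> i \<in> L2 (law f0)" "\<And>i. \<phi> i \<in> L2 (law f1)"
  shows "crit f0 f1 (stat \<phi> k0 k) = (k \<bullet> (F_mat f0 f1 \<phi> *v k)) / (k \<bullet> Y_vec f0 f1 \<phi>)\<^sup>2"
  unfolding crit_def
  unfolding variance_stat[of f0 \<phi>, OF d(1) \<phi>(1)] variance_stat[of f1 \<phi>, OF d(2) \<phi>(2)]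
  unfolding expectation_stat[of f0 \<phi>, OF d(1) \<phi>(1)] expectation_stat[of f1 \<phi>, OF d(2) \<phi>(2)] F_mat_def Y_vec_def
  by (simp add: inner_diff_right inner_add_right matrix_vector_mult_add_rdistrib)

text \<open>The quadratic form of the second covariance matrix is a variance, hence nonnegative;
  strict positivity comes from the first.\<close>

lemma pos_def_F_mat:
  fixes \<phi> :: "'n::finite \<Rightarrow> real \<Rightarrow> real"
  assumes d1: "prob_density f1" and \<phi>: "\<And>i. \<phi> i \<in> L2 (law f1)"
    and C0: "pos_def (cov_mat f0 \<phi>)"
  shows "pos_def (F_mat f0 f1 \<phi>)"
  unfolding pos_def_def
proof (intro conjI allI impI)
  show "transpose (F_mat f0 f1 \<phi>) = F_mat f0 f1 \<phi>"
    by (simp add: F_mat_def transpose_def cov_mat_def vec_eq_iff mult.commute)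
  fix v :: "real ^ 'n" assume "v \<noteq> 0"
  then have "0 < v \<bullet> (cov_mat f0 \<phi> *v v)" using C0 by (simp add: pos_def_def)
  moreover have "0 \<le> v \<bullet> (cov_mat f1 \<phi> *v v)"
    unfolding variance_stat[of f1 \<phi> 0 v, OF d1 \<phi>, symmetric] by simp
  ultimately show "0 < v \<bullet> (F_mat f0 f1 \<phi> *v v)"
    by (simp add: F_mat_def matrix_vector_mult_add_rdistrib inner_add_right)
qed

section \<open>Generalised Rayleigh quotients\<close>

text \<open>A kernel vector makes the quadratic form zero, so the kernel is trivial.\<close>

lemma pos_def_invertible:
  fixes A :: "real ^ 'n ^ 'n"
  assumes "pos_def A"
  shows "invertible A"
proof -
  have "x = 0" if "A *v x = 0" for x
    using assms that unfolding pos_def_def by (metis inner_zero_right less_irrefl)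
  then show ?thesis
    by (simp add: invertible_left_inverse matrix_left_invertible_ker)
qed

lemma matrix_inv_inverse:
  assumes "invertible A"
  shows "A ** matrix_inv A = mat 1" "matrix_inv A ** A = mat 1"
  using someI_ex[OF assms[unfolded invertible_def]] unfolding matrix_inv_def by blast+

lemma matrix_inv_solve:
  fixes A :: "real ^ 'n ^ 'n"
  assumes "invertible A"
  shows "A *v x = y \<longleftrightarrow> x = matrix_inv A *v y"
  using matrix_inv_inverse[OF assms]
  by (metis matrix_vector_mul_assoc matrix_vector_mul_lid)

lemma symmetric_inner_mult:
  fixes A :: "real ^ 'n ^ 'n"
  assumes "transpose A = A"
  shows "x \<bullet> (A *v y) = (A *v x) \<bullet> y"
  using dot_lmul_matrix[of x A y] assms by (metis vector_transpose_matrix)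

text \<open>Cauchy-Schwarz for the inner product of \<open>A\<close>, applied to \<open>k\<close>
  and \<open>K\<close>, where \<open>k \<bullet> y\<close> is their \<open>A\<close>-inner product.
  At \<open>k = K\<close> the quotient is \<open>(K \<bullet> y) / (K \<bullet> y)\<^sup>2\<close>,
  which explains the value of the minimum.\<close>

lemma
  fixes A :: "real ^ 'n ^ 'n"
  assumes A: "pos_def A" and K: "A *v K = y" and ky: "k \<bullet> y \<noteq> 0"
  shows rayleigh_ge: "1 / (K \<bullet> y) \<le> (k \<bullet> (A *v k)) / (k \<bullet> y)\<^sup>2"
    and rayleigh_eq_iff: "(k \<bullet> (A *v k)) / (k \<bullet> y)\<^sup>2 = 1 / (K \<bullet> y) \<longleftrightarrow> (\<exists>c. c \<noteq> 0 \<and> k = c *\<^sub>R K)"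
proof -
  have pos: "0 < v \<bullet> (A *v v)" if "v \<noteq> 0" for v
    using A that by (simp add: pos_def_def)
  have sym: "x \<bullet> (A *v z) = (A *v x) \<bullet> z" for x z
    using A by (simp add: pos_def_def symmetric_inner_mult)
  have "y \<noteq> 0" using ky by auto
  then have J: "0 < K \<bullet> y"
    using pos[of K] K by (metis matrix_vector_mult_0_right)
  \<comment> \<open>\<open>t *\<^sub>R K\<close> is the \<open>A\<close>-orthogonal projection of
    \<open>k\<close> onto the line of \<open>K\<close>; the squared \<open>A\<close>-length of the
    remainder is exactly the defect in the inequality.\<close>
  define t where "t = (k \<bullet> y) / (K \<bullet> y)"
  let ?d = "k - t *\<^sub>R K"
  have "?d \<bullet> (A *v ?d) = k \<bullet> (A *v k) - 2 * t * (k \<bullet> y) + t\<^sup>2 * (K \<bullet> y)"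
    using sym[of K k] K
    by (simp add: matrix_vector_mult_diff_distrib matrix_vector_mult_scaleR algebra_simps
        inner_commute power2_eq_square)
  also have "\<dots> = k \<bullet> (A *v k) - (k \<bullet> y)\<^sup>2 / (K \<bullet> y)"
    using J by (simp add: t_def power2_eq_square field_simps)
  finally have d: "?d \<bullet> (A *v ?d) = k \<bullet> (A *v k) - (k \<bullet> y)\<^sup>2 / (K \<bullet> y)" .
  have "0 \<le> ?d \<bullet> (A *v ?d)"
    using pos[of ?d] by (cases "?d = 0") auto
  then have "(k \<bullet> y)\<^sup>2 / (K \<bullet> y) \<le> k \<bullet> (A *v k)" using d by simp
  with J ky show "1 / (K \<bullet> y) \<le> (k \<bullet> (A *v k)) / (k \<bullet> y)\<^sup>2"
    by (simp add: field_simps)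
  have "(k \<bullet> (A *v k)) / (k \<bullet> y)\<^sup>2 = 1 / (K \<bullet> y) \<longleftrightarrow> ?d \<bullet> (A *v ?d) = 0"
    using J ky by (auto simp: d field_simps)
  also have "\<dots> \<longleftrightarrow> k = t *\<^sub>R K"
    using pos[of ?d] by (cases "?d = 0") auto
  also have "\<dots> \<longleftrightarrow> (\<exists>c. c \<noteq> 0 \<and> k = c *\<^sub>R K)"
  proof -
    have "t \<noteq> 0" using J ky by (simp add: t_def)
    \<comment> \<open>Pairing \<open>k = c *\<^sub>R K\<close> with \<open>y\<close> determines the
      scalar.\<close>
    moreover have "c = t" if "k = c *\<^sub>R K" for c
      using that J by (simp add: t_def)
    ultimately show ?thesis by blast
  qed
  finally show "(k \<bullet> (A *v k)) / (k \<bullet> y)\<^sup>2 = 1 / (K \<bullet> y) \<longleftrightarrow> (\<exists>c. c \<noteq> 0 \<and> k = c *\<^sub>R K)" .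
qed

section \<open>Gradient and stationary points of the quotient\<close>

lemma GDERIV_unique:
  assumes "GDERIV f x :> D" "GDERIV f x :> E"
  shows "D = E"
proof -
  have "(\<lambda>h. h \<bullet> D) = (\<lambda>h. h \<bullet> E)"
    using assms unfolding gderiv_def by (rule has_derivative_unique)
  then show ?thesis by (metis vector_eq_ldot)
qed

lemma GDERIV_rayleigh:
  fixes A :: "real ^ 'n ^ 'n"
  assumes A: "transpose A = A" and ky: "k \<bullet> y \<noteq> 0"
  shows "GDERIV (\<lambda>k. (k \<bullet> (A *v k)) / (k \<bullet> y)\<^sup>2) k
    :> (2 / (k \<bullet> y)\<^sup>2) *\<^sub>R (A *v k - ((k \<bullet> (A *v k)) / (k \<bullet> y)) *\<^sub>R y)"
proof -
  have lin: "((*v) A has_derivative (*v) A) (at k)"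
    by (intro bounded_linear_imp_has_derivative matrix_vector_mul_bounded_linear)
  have num: "((\<lambda>k. k \<bullet> (A *v k)) has_derivative (\<lambda>h. k \<bullet> (A *v h) + h \<bullet> (A *v k))) (at k)"
    by (rule has_derivative_inner[OF has_derivative_ident lin])
  have den: "((\<lambda>k. (k \<bullet> y)\<^sup>2) has_derivative (\<lambda>h. 2 * (k \<bullet> y) * (h \<bullet> y))) (at k)"
    by (auto intro!: derivative_eq_intros simp: algebra_simps)
  have "((k \<bullet> (A *v h) + h \<bullet> (A *v k)) * (k \<bullet> y)\<^sup>2 - (k \<bullet> (A *v k)) * (2 * (k \<bullet> y) * (h \<bullet> y)))
      / ((k \<bullet> y)\<^sup>2 * (k \<bullet> y)\<^sup>2)
    = h \<bullet> ((2 / (k \<bullet> y)\<^sup>2) *\<^sub>R (A *v k - ((k \<bullet> (A *v k)) / (k \<bullet> y)) *\<^sub>R y))" for h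
  proof -
    \<comment> \<open>Scalar form of the quotient rule: \<open>a\<close> stands for
      \<open>h \<bullet> (A *v k)\<close>, \<open>b\<close> for \<open>h \<bullet> y\<close>,
      \<open>l\<close> for \<open>k \<bullet> y\<close> and \<open>q\<close> for
      \<open>k \<bullet> (A *v k)\<close>. Symmetry of \<open>A\<close> merges the two terms of the
      numerator's derivative into \<open>a + a\<close>.\<close>
    have "((a + a) * l\<^sup>2 - q * (2 * l * b)) / (l\<^sup>2 * l\<^sup>2) = 2 / l\<^sup>2 * (a - q / l * b)"
      if "l \<noteq> 0" for a b l q :: real
      using that by (simp add: field_simps power2_eq_square)
    moreover have "k \<bullet> (A *v h) = h \<bullet> (A *v k)"
      using symmetric_inner_mult[OF A, of k h] by (simp add: inner_commute)
    ultimately show ?thesis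
      using ky by (simp only: inner_scaleR_right inner_diff_right)
  qed
  then show ?thesis
    unfolding gderiv_def using has_derivative_divide'[OF num den] ky by simp
qed

text \<open>The gradient vanishes exactly when \<open>A *v k\<close> is one specific multiple of
  \<open>y\<close>. Proportionality with any scalar suffices, because pairing with \<open>k\<close>
  forces the scalar to be that one.\<close>

lemma GDERIV_rayleigh_zero_iff:
  fixes A :: "real ^ 'n ^ 'n"
  assumes A: "transpose A = A" and ky: "k \<bullet> y \<noteq> 0"
  shows "GDERIV (\<lambda>k. (k \<bullet> (A *v k)) / (k \<bullet> y)\<^sup>2) k :> 0 \<longleftrightarrow> (\<exists>c. A *v k = c *\<^sub>R y)"
proof -
  note D = GDERIV_rayleigh[OF A ky]
  have "GDERIV (\<lambda>k. (k \<bullet> (A *v k)) / (k \<bullet> y)\<^sup>2) k :> 0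
      \<longleftrightarrow> A *v k = ((k \<bullet> (A *v k)) / (k \<bullet> y)) *\<^sub>R y"
    using D GDERIV_unique[OF D, of 0] ky by auto
  also have "\<dots> \<longleftrightarrow> (\<exists>c. A *v k = c *\<^sub>R y)"
    using ky by auto
  finally show ?thesis .
qed

section \<open>The score projection\<close>

text \<open>Brings \<Lambda> under the moment formulas for affine statistics.\<close>

lemma Lam_eq_stat:
  "Lam f0 f1 \<phi> = stat \<phi> (- (K_vec f0 f1 \<phi> \<bullet> (mean_vec f0 \<phi> + mean_vec f1 \<phi>)) / 2) (K_vec f0 f1 \<phi>)"
  by (auto simp: Lam_def stat_def inner_diff_right)

text \<open>Centring at the midpoint of the two mean vectors places the two means of \<Lambda>
  symmetrically about 0, at distance \<open>K \<bullet> Y = J\<close>.\<close>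

lemma
  assumes d: "prob_density f0" "prob_density f1"
    and \<phi>: "\<And>i. \<phi> i \<in> L2 (law f0)" "\<And>i. \<phi> i \<in> L2 (law f1)"
  shows expectation_Lam0: "(\<integral>x. Lam f0 f1 \<phi> x \<partial>law f0) = - (J_val f0 f1 \<phi> / 2)"
    and expectation_Lam1: "(\<integral>x. Lam f0 f1 \<phi> x \<partial>law f1) = J_val f0 f1 \<phi> / 2"
proof -
  have J: "J_val f0 f1 \<phi> = K_vec f0 f1 \<phi> \<bullet> (mean_vec f1 \<phi> - mean_vec f0 \<phi>)"
    by (simp add: J_val_def K_vec_def Y_vec_def inner_commute)
  show "(\<integral>x. Lam f0 f1 \<phi> x \<partial>law f0) = - (J_val f0 f1 \<phi> / 2)"
    unfolding Lam_eq_stat expectation_stat[of f0 \<phi>, OF d(1) \<phi>(1)] J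
    by (simp add: inner_diff_right inner_add_right field_simps)
  show "(\<integral>x. Lam f0 f1 \<phi> x \<partial>law f1) = J_val f0 f1 \<phi> / 2"
    unfolding Lam_eq_stat expectation_stat[of f1 \<phi>, OF d(2) \<phi>(2)] J
    by (simp add: inner_diff_right inner_add_right field_simps)
qed

text \<open>Under each law the cross moment is a covariance part plus mean times mean. The means of
  \<Lambda> are opposite, so averaging leaves \<open>F K\<close> plus \<open>J / 2\<close> times
  \<open>Y\<close>, all halved; the normal system turns this into a multiple of
  \<open>Y\<close>.\<close>

lemma inner_Lam_dictionary:
  assumes d: "prob_density f0" "prob_density f1"
    and \<phi>: "\<And>i. \<phi> i \<in> L2 (law f0)" "\<And>i. \<phi> i \<in> L2 (law f1)"
    and FK: "F_mat f0 f1 \<phi> *v K_vec f0 f1 \<phi> = Y_vec f0 f1 \<phi>"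
  shows "L2_inner (avg_law f0 f1) (Lam f0 f1 \<phi>) (\<phi> i)
    = (1 + J_val f0 f1 \<phi> / 2) * (Y_vec f0 f1 \<phi> $ i / 2)"
proof -
  let ?K = "K_vec f0 f1 \<phi>" and ?J = "J_val f0 f1 \<phi>" and ?L = "Lam f0 f1 \<phi>"
  have L: "?L \<in> L2 (law f0)" "?L \<in> L2 (law f1)"
    unfolding Lam_eq_stat using d \<phi> by (auto intro: stat_L2 finite_measure_law)
  have e0: "(\<integral>x. \<phi> i x * ?L x \<partial>law f0)
      = (cov_mat f0 \<phi> *v ?K) $ i - mean_vec f0 \<phi> $ i * (?J / 2)"
    using expectation_Lam0[of f0 f1 \<phi>, OF d \<phi>] unfolding Lam_eq_stat expectation_mult_stat[of f0 \<phi>, OF d(1) \<phi>(1)]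
    by (simp add: expectation_stat[of f0 \<phi>, OF d(1) \<phi>(1)])
  have e1: "(\<integral>x. \<phi> i x * ?L x \<partial>law f1)
      = (cov_mat f1 \<phi> *v ?K) $ i + mean_vec f1 \<phi> $ i * (?J / 2)"
    using expectation_Lam1[of f0 f1 \<phi>, OF d \<phi>] unfolding Lam_eq_stat expectation_mult_stat[of f1 \<phi>, OF d(2) \<phi>(2)]
    by (simp add: expectation_stat[of f1 \<phi>, OF d(2) \<phi>(2)])
  have "L2_inner (avg_law f0 f1) ?L (\<phi> i)
      = ((\<integral>x. \<phi> i x * ?L x \<partial>law f0) + (\<integral>x. \<phi> i x * ?L x \<partial>law f1)) / 2"
    by (subst L2_inner_commute, unfold L2_inner_def)
      (intro integral_avg_law d L2_mult_integrable \<phi> L)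
  also have "\<dots> = ((F_mat f0 f1 \<phi> *v ?K) $ i + Y_vec f0 f1 \<phi> $ i * (?J / 2)) / 2"
    unfolding e0 e1 F_mat_def Y_vec_def
    by (simp add: matrix_vector_mult_add_rdistrib algebra_simps)
  also have "\<dots> = (1 + ?J / 2) * (Y_vec f0 f1 \<phi> $ i / 2)"
    unfolding FK by (simp add: field_simps)
  finally show ?thesis .
qed

lemma inner_bounded_score_dictionary:
  assumes d: "prob_density f0" "prob_density f1"
    and \<phi>: "\<phi> i \<in> L2 (law f0)" "\<phi> i \<in> L2 (law f1)"
  shows "L2_inner (avg_law f0 f1) (bounded_score f0 f1) (\<phi> i) = Y_vec f0 f1 \<phi> $ i / 2"
  unfolding L2_inner_def
  using integral_bounded_score_mult[OF d, of "\<phi> i"] d \<phi>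
  by (simp add: L2_integrable finite_measure_law Y_vec_def mean_vec_def)

text \<open>The pairings of the score and of \<Lambda> with every \<open>\<phi> i\<close> are
  proportional with the same factor \<open>1 + J / 2\<close>, so dividing by it makes them agree.
  Against the constant 1 both vanish.\<close>

lemma bounded_score_residual:
  assumes d: "prob_density f0" "prob_density f1"
    and \<phi>: "\<And>i. \<phi> i \<in> L2 (law f0)" "\<And>i. \<phi> i \<in> L2 (law f1)"
    and FK: "F_mat f0 f1 \<phi> *v K_vec f0 f1 \<phi> = Y_vec f0 f1 \<phi>"
    and J: "0 < J_val f0 f1 \<phi>" and v: "v \<in> span1 UNIV \<phi>"
  shows "L2_inner (avg_law f0 f1)
    (\<lambda>x. bounded_score f0 f1 x - Lam f0 f1 \<phi> x / (1 + J_val f0 f1 \<phi> / 2)) v = 0"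
proof -
  let ?M = "avg_law f0 f1" and ?h = "bounded_score f0 f1" and ?L = "Lam f0 f1 \<phi>"
  let ?c = "1 / (1 + J_val f0 f1 \<phi> / 2)"
  have M: "finite_measure ?M" by (rule finite_measure_avg_law[OF d])
  have h: "?h \<in> L2 ?M" by (rule bounded_score_L2[OF d])
  have \<phi>M: "\<phi> i \<in> L2 ?M" for i by (rule L2_avg_law[OF d \<phi>])
  have L: "?L \<in> L2 ?M"
    unfolding Lam_eq_stat by (rule stat_L2[OF M \<phi>M])
  have LI: "integrable (law f0) ?L" "integrable (law f1) ?L"
    unfolding Lam_eq_stat using d \<phi> by (auto intro!: L2_integrable stat_L2 finite_measure_law)
  have cL: "(\<lambda>x. ?c * ?L x) \<in> L2 ?M" by (rule L2_cmult[OF L])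
  have "L2_inner ?M (\<lambda>x. ?h x - ?c * ?L x) v = 0"
  proof (rule orthogonal_span1[OF M L2_diff[OF h cL] \<phi>M _ _ v])
    have "(\<integral>x. ?L x \<partial>?M) = 0"
      using integral_avg_law[OF d LI] expectation_Lam0[of f0 f1 \<phi>, OF d \<phi>]
        expectation_Lam1[of f0 f1 \<phi>, OF d \<phi>] by simp
    then show "(\<integral>x. ?h x - ?c * ?L x \<partial>?M) = 0"
      using L2_integrable[OF M h] L2_integrable[OF M L] integral_bounded_score[OF d] by simp
  next
    fix i
    have "L2_inner ?M (\<lambda>x. ?c * ?L x) (\<phi> i) = ?c * L2_inner ?M ?L (\<phi> i)"
      unfolding L2_inner_def using L2_mult_integrable[OF L \<phi>M] by (simp add: mult.assoc)
    also have "\<dots> = Y_vec f0 f1 \<phi> $ i / 2"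
      unfolding inner_Lam_dictionary[of f0 f1 \<phi>, OF d \<phi> FK] using J by (simp add: field_simps)
    finally show "L2_inner ?M (\<lambda>x. ?h x - ?c * ?L x) (\<phi> i) = 0"
      unfolding L2_inner_diff_left[OF h cL \<phi>M]
      by (simp add: inner_bounded_score_dictionary[of f0 f1 \<phi> i, OF d \<phi>])
  qed
  then show ?thesis by simp
qed

text \<open>The rescaled \<Lambda> is the explicit candidate for the projection. For the norm,
  orthogonality of the residual to \<open>p\<close> replaces \<open>L2_inner ?M ?p ?p\<close> by the
  pairing of \<open>p\<close> with the score, which is half the difference of the two means of
  \<open>p\<close>.\<close>

lemma
  assumes d: "prob_density f0" "prob_density f1"
    and \<phi>: "\<And>i. \<phi> i \<in> L2 (law f0)" "\<And>i. \<phi> i \<in> L2 (law f1)"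
    and FK: "F_mat f0 f1 \<phi> *v K_vec f0 f1 \<phi> = Y_vec f0 f1 \<phi>"
    and J: "0 < J_val f0 f1 \<phi>"
  shows bounded_score_proj: "AE x in avg_law f0 f1.
      L2_proj (avg_law f0 f1) (span1 UNIV \<phi>) (bounded_score f0 f1) x
        = Lam f0 f1 \<phi> x / (1 + J_val f0 f1 \<phi> / 2)"
    and bounded_score_proj_norm: "(L2_norm (avg_law f0 f1)
      (L2_proj (avg_law f0 f1) (span1 UNIV \<phi>) (bounded_score f0 f1)))\<^sup>2
        = J_val f0 f1 \<phi> / (2 + J_val f0 f1 \<phi>)"
proof -
  let ?M = "avg_law f0 f1" and ?h = "bounded_score f0 f1" and ?L = "Lam f0 f1 \<phi>"
  let ?J = "J_val f0 f1 \<phi>" and ?P = "L2_proj (avg_law f0 f1) (span1 UNIV \<phi>) (bounded_score f0 f1)"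
  let ?p = "\<lambda>x. Lam f0 f1 \<phi> x / (1 + J_val f0 f1 \<phi> / 2)"
  have M: "finite_measure ?M" by (rule finite_measure_avg_law[OF d])
  have h: "?h \<in> L2 ?M" by (rule bounded_score_L2[OF d])
  have \<phi>M: "\<phi> i \<in> L2 ?M" for i by (rule L2_avg_law[OF d \<phi>])
  have p: "?p \<in> span1 UNIV \<phi>"
  proof -
    have "?p = stat \<phi> (- (K_vec f0 f1 \<phi> \<bullet> (mean_vec f0 \<phi> + mean_vec f1 \<phi>)) / 2 / (1 + ?J / 2))
        ((1 / (1 + ?J / 2)) *\<^sub>R K_vec f0 f1 \<phi>)"
      unfolding Lam_eq_stat stat_def
      by (simp only: add_divide_distrib inner_scaleR_left times_divide_eq_left mult_1)
    then show ?thesis by (simp only: stat_in_span1)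
  qed
  note V = span1_subset_L2[of ?M UNIV \<phi>, OF M \<phi>M]
  note res = bounded_score_residual[of f0 f1 \<phi>, OF d \<phi> FK J]
  show ae: "AE x in ?M. ?P x = ?p x"
    by (rule L2_proj_unique[OF V span1_diff h p res])
  have pL2: "?p \<in> L2 ?M" using p V by blast
  have PL2: "?P \<in> L2 ?M" using L2_proj_in[OF p res] V by blast
  have LI: "integrable (law f0) ?L" "integrable (law f1) ?L"
    unfolding Lam_eq_stat using d \<phi> by (auto intro!: L2_integrable stat_L2 finite_measure_law)
  have "(L2_norm ?M ?P)\<^sup>2 = L2_inner ?M ?P ?P"
    by (simp add: L2_norm_def L2_inner_self_nonneg)
  \<comment> \<open>The chosen projection is known only up to null sets, which the integral does not
    see.\<close>
  also have "\<dots> = L2_inner ?M ?p ?p"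
    unfolding L2_inner_def
    by (intro integral_cong_AE borel_measurable_times)
      (use L2_measurable[OF pL2] L2_measurable[OF PL2] ae in auto)
  also have "\<dots> = L2_inner ?M ?h ?p"
    using res[OF p] L2_inner_diff_left[OF h pL2 pL2] by simp
  also have "\<dots> = ((\<integral>x. ?p x \<partial>law f1) - (\<integral>x. ?p x \<partial>law f0)) / 2"
    unfolding L2_inner_def using LI by (intro integral_bounded_score_mult[OF d]) auto
  also have "\<dots> = ?J / (1 + ?J / 2) / 2"
    unfolding integral_divide_zero expectation_Lam0[of f0 f1 \<phi>, OF d \<phi>]
      expectation_Lam1[of f0 f1 \<phi>, OF d \<phi>]
    by (simp only: diff_divide_distrib[symmetric] diff_minus_eq_add field_sum_of_halves)
  also have "\<dots> = ?J / (2 + ?J)"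
    using J by (simp add: field_simps)
  finally show "(L2_norm ?M ?P)\<^sup>2 = ?J / (2 + ?J)" .
qed

theorem proposition3p1:
  fixes f0 f1 :: "real \<Rightarrow> real" and \<phi> :: "'n::finite \<Rightarrow> real \<Rightarrow> real"
  assumes dens0: "prob_density f0" and dens1: "prob_density f1"
    and mom: "moment_assumption f0 f1 \<phi>"
    and Y_nz: "Y_vec f0 f1 \<phi> \<noteq> 0"
  shows
    "(\<forall>k0 k. k \<bullet> Y_vec f0 f1 \<phi> \<noteq> 0 \<longrightarrow>
        crit f0 f1 (stat \<phi> k0 k) =
          (k \<bullet> ((cov_mat f0 \<phi> + cov_mat f1 \<phi>) *v k)) / (k \<bullet> Y_vec f0 f1 \<phi>)\<^sup>2 \<and>
        crit f0 f1 (stat \<phi> k0 k) \<ge> 1 / J_val f0 f1 \<phi> \<and>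
        (crit f0 f1 (stat \<phi> k0 k) = 1 / J_val f0 f1 \<phi> \<longleftrightarrow>
          (\<exists>c. c \<noteq> 0 \<and> k = c *\<^sub>R K_vec f0 f1 \<phi>)) \<and>
        (\<lambda>k'. crit f0 f1 (stat \<phi> k0 k')) differentiable (at k) \<and>
        (GDERIV (\<lambda>k'. crit f0 f1 (stat \<phi> k0 k')) k :> 0 \<longleftrightarrow>
          (\<exists>c. (cov_mat f0 \<phi> + cov_mat f1 \<phi>) *v k = c *\<^sub>R Y_vec f0 f1 \<phi>)))
     \<and> (\<forall>k. F_mat f0 f1 \<phi> *v k = Y_vec f0 f1 \<phi> \<longleftrightarrow> k = K_vec f0 f1 \<phi>)
     \<and> K_vec f0 f1 \<phi> \<bullet> Y_vec f0 f1 \<phi> \<noteq> 0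
     \<and> (\<forall>k0. GDERIV (\<lambda>k'. crit f0 f1 (stat \<phi> k0 k')) (K_vec f0 f1 \<phi>) :> 0)
     \<and> (AE x in avg_law f0 f1.
          Lam f0 f1 \<phi> x =
            (1 + J_val f0 f1 \<phi> / 2) *
              L2_proj (avg_law f0 f1) (span1 UNIV \<phi>) (bounded_score f0 f1) x)
     \<and> (L2_norm (avg_law f0 f1)
            (L2_proj (avg_law f0 f1) (span1 UNIV \<phi>) (bounded_score f0 f1)))\<^sup>2
          = J_val f0 f1 \<phi> / (2 + J_val f0 f1 \<phi>)
     \<and> (orthonormal_centred (avg_law f0 f1) \<phi> \<longrightarrow>
          (\<forall>i. Y_vec f0 f1 \<phi> $ i = 2 * L2_inner (avg_law f0 f1) (\<phi> i) (bounded_score f0 f1)))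
     \<and> (\<forall>\<psi> :: nat \<Rightarrow> real \<Rightarrow> real.
          (\<forall>i. \<psi> i \<in> L2 (law f0) \<and> \<psi> i \<in> L2 (law f1)) \<and>
          orthonormal_centred (avg_law f0 f1) \<psi> \<and>
          complete_with_one (avg_law f0 f1) \<psi> \<longrightarrow>
          (\<forall>s. AE x in avg_law f0 f1.
             L2_proj (avg_law f0 f1) (span1 {..<s} \<psi>) (bounded_score f0 f1) x =
               (\<Sum>i<s. L2_inner (avg_law f0 f1) (\<psi> i) (bounded_score f0 f1) * \<psi> i x)) \<and>
          (\<lambda>s. L2_norm (avg_law f0 f1) (\<lambda>x.
             L2_proj (avg_law f0 f1) (span1 {..<s} \<psi>) (bounded_score f0 f1) x
               - bounded_score f0 f1 x)) \<longlonglongrightarrow> 0)"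
proof -
  let ?F = "F_mat f0 f1 \<phi>" and ?Y = "Y_vec f0 f1 \<phi>" and ?K = "K_vec f0 f1 \<phi>"
  let ?J = "J_val f0 f1 \<phi>" and ?M = "avg_law f0 f1" and ?h = "bounded_score f0 f1"
  note d = dens0 dens1
  have \<phi>: "\<And>i. \<phi> i \<in> L2 (law f0)" "\<And>i. \<phi> i \<in> L2 (law f1)"
    and C0: "pos_def (cov_mat f0 \<phi>)"
    using mom by (auto simp: moment_assumption_def)
  have F: "pos_def ?F" by (rule pos_def_F_mat[of f1 \<phi> f0, OF dens1 \<phi>(2) C0])
  then have Fsym: "transpose ?F = ?F" by (simp add: pos_def_def)
  have normal: "?F *v k = ?Y \<longleftrightarrow> k = ?K" for k
    unfolding K_vec_def by (rule matrix_inv_solve[OF pos_def_invertible[OF F]])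
  then have FK: "?F *v ?K = ?Y" by simp
  have KY: "?K \<bullet> ?Y = ?J" by (simp add: J_val_def K_vec_def inner_commute)
  \<comment> \<open>\<open>Y\<close> is nonzero, hence so is \<open>K\<close> by the normal system,
    and \<open>J\<close> is the quadratic form of \<open>F\<close> at \<open>K\<close>.\<close>
  have J: "0 < ?J"
    using F FK Y_nz unfolding KY[symmetric] pos_def_def by (metis matrix_vector_mult_0_right)
  then have KY0: "?K \<bullet> ?Y \<noteq> 0" using KY by simp
  note crit = crit_stat[of f0 f1 \<phi>, OF d \<phi>]
  have part1: "crit f0 f1 (stat \<phi> k0 k) = (k \<bullet> (?F *v k)) / (k \<bullet> ?Y)\<^sup>2 \<and>
      crit f0 f1 (stat \<phi> k0 k) \<ge> 1 / ?J \<and>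
      (crit f0 f1 (stat \<phi> k0 k) = 1 / ?J \<longleftrightarrow> (\<exists>c. c \<noteq> 0 \<and> k = c *\<^sub>R ?K)) \<and>
      (\<lambda>k'. crit f0 f1 (stat \<phi> k0 k')) differentiable (at k) \<and>
      (GDERIV (\<lambda>k'. crit f0 f1 (stat \<phi> k0 k')) k :> 0 \<longleftrightarrow> (\<exists>c. ?F *v k = c *\<^sub>R ?Y))"
    if ky: "k \<bullet> ?Y \<noteq> 0" for k0 k
    \<comment> \<open>The quotient formula holds for every coefficient vector, including those with
      \<open>k \<bullet> Y = 0\<close>, where both sides are divisions by zero. It can therefore be
      rewritten under the abstraction over \<open>k'\<close>, as the derivative statements
      require.\<close>
    unfolding crit
    using rayleigh_ge[OF F FK ky] rayleigh_eq_iff[OF F FK ky] GDERIV_rayleigh_zero_iff[OF Fsym ky]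
      GDERIV_rayleigh[OF Fsym ky]
    by (auto simp: KY gderiv_def differentiable_def)
  have grad: "GDERIV (\<lambda>k'. crit f0 f1 (stat \<phi> k0 k')) ?K :> 0" for k0
  proof -
    have "\<exists>c. ?F *v ?K = c *\<^sub>R ?Y" by (rule exI[of _ 1]) (simp add: FK)
    then show ?thesis using part1[OF KY0] by blast
  qed
  \<comment> \<open>Positivity of \<open>J\<close> keeps \<open>1 + J / 2\<close> away from 0, so
    the division in the projection formula can be cleared.\<close>
  have proj: "AE x in ?M. Lam f0 f1 \<phi> x = (1 + ?J / 2) * L2_proj ?M (span1 UNIV \<phi>) ?h x"
    using bounded_score_proj[of f0 f1 \<phi>, OF d \<phi> FK J] by eventually_elim (use J in \<open>simp add: field_simps\<close>)
  have fourier: "?Y $ i = 2 * L2_inner ?M (\<phi> i) ?h" for i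
    using inner_bounded_score_dictionary[of f0 f1 \<phi> i, OF d \<phi>] by (simp add: L2_inner_commute)
  have M: "finite_measure ?M" by (rule finite_measure_avg_law[OF d])
  have h: "?h \<in> L2 ?M" by (rule bounded_score_L2[OF d])
  have h0: "(\<integral>x. ?h x \<partial>?M) = 0" by (rule integral_bounded_score[OF d])
  have complete: "(\<forall>s. AE x in ?M. L2_proj ?M (span1 {..<s} \<psi>) ?h x
        = (\<Sum>i<s. L2_inner ?M (\<psi> i) ?h * \<psi> i x)) \<and>
      (\<lambda>s. L2_norm ?M (\<lambda>x. L2_proj ?M (span1 {..<s} \<psi>) ?h x - ?h x)) \<longlonglongrightarrow> 0"
    if "(\<forall>i. \<psi> i \<in> L2 (law f0) \<and> \<psi> i \<in> L2 (law f1)) \<and>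
      orthonormal_centred ?M \<psi> \<and> complete_with_one ?M \<psi>" for \<psi> :: "nat \<Rightarrow> real \<Rightarrow> real"
  proof -
    have "\<And>i. \<psi> i \<in> L2 ?M" using that L2_avg_law[OF d] by blast
    then show ?thesis
      using orthonormal_proj[OF M h _ _ h0 finite_lessThan]
        complete_orthonormal_proj_tendsto[OF M h _ _ h0] that by blast
  qed
  show ?thesis
    unfolding F_mat_def[symmetric]
    by (rule conjI, intro allI impI, rule part1, assumption,
        rule conjI, rule allI, rule normal, rule conjI, rule KY0, rule conjI, rule allI, rule grad,
        rule conjI, rule proj, rule conjI, rule bounded_score_proj_norm[of f0 f1 \<phi>, OF d \<phi> FK J],
        rule conjI, intro impI allI, rule fourier, intro allI impI, rule complete, assumption)
qed

end
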